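(* Let $x$ and $y$ be reordered computable numbers. Then the sum $x+y$ is also reordered computable.
   Context: $\mathbb{N}=\{0,1,2,\dots\}$. A function $f\colon\mathbb{N}\to\mathbb{N}$ tends to infinity if for every $c$ there is $m$ with $f(n)>c$ for all $n\ge m$. For such $f$, $u_f(n) := |\{k\in\mathbb{N} \mid f(k)=n\}|$. A function $f\colon\mathbb{N}\to\mathbb{N}$ is a name for a real number $x$ if $\sum_{k=0}^\infty 2^{-f(k)} = x$ (then $f$ tends to infinity). A convergent sequence $(x_n)_n$ with limit $x$ converges computably if there is a computable $s\colon\mathbb{N}\to\mathbb{N}$ with $|x-x_k|\le 2^{-n}$ for all $n$ and all $k\ge s(n)$; a series converges computably if the sequence of its partial sums $\left(\sum_{k=0}^{n-1}a_k\right)_n$ does (no computability of the terms is required). A real number is reordered computable if it has a computable name $f$ such that $\sum_{k=0}^\infty u_f(k)\cdot 2^{-k}$ converges computably. *)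

theory Defs
  imports Complex_Main
begin

text \<open>Partial recursive functions. Arities are not tracked by the syntax; a program applied to an
  argument list of unsuitable length simply has no value, or ignores surplus arguments.\<close>

datatype recf =
    Zero
  | Succ
  | Proj nat
  | Comp recf "recf list"
  | PrimRec recf recf
  | Mu recf

inductive eval :: "recf \<Rightarrow> nat list \<Rightarrow> nat \<Rightarrow> bool" where
  Zero: "eval Zero xs 0"
| Succ: "eval Succ (x # xs) (Suc x)"
| Proj: "i < length xs \<Longrightarrow> eval (Proj i) xs (xs ! i)"
| Comp: "list_all2 (\<lambda>g y. eval g xs y) gs ys \<Longrightarrow> eval f ys z \<Longrightarrow> eval (Comp f gs) xs z"
| PrimRec_0: "eval f xs y \<Longrightarrow> eval (PrimRec f g) (0 # xs) y"
| PrimRec_Suc: "eval (PrimRec f g) (n # xs) y \<Longrightarrow> eval g (n # y # xs) z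
    \<Longrightarrow> eval (PrimRec f g) (Suc n # xs) z"
| Mu: "eval f (n # xs) 0 \<Longrightarrow> (\<And>m. m < n \<Longrightarrow> \<exists>k. eval f (m # xs) (Suc k))
    \<Longrightarrow> eval (Mu f) xs n"

inductive_cases eval_ZeroE: "eval Zero xs y"
inductive_cases eval_SuccE: "eval Succ xs y"
inductive_cases eval_ProjE: "eval (Proj i) xs y"
inductive_cases eval_CompE: "eval (Comp f gs) xs y"
inductive_cases eval_PrimRec_0E: "eval (PrimRec f g) (0 # xs) y"
inductive_cases eval_PrimRec_SucE: "eval (PrimRec f g) (Suc n # xs) y"
inductive_cases eval_MuE: "eval (Mu f) xs y"

lemma eval_deterministic: "eval r xs y \<Longrightarrow> eval r xs z \<Longrightarrow> y = z"
proof (induction r xs y arbitrary: z rule: eval.induct)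
  case (Zero xs z)
  from Zero.prems show ?case by (rule eval_ZeroE) simp
next
  case (Succ x xs z)
  from Succ.prems show ?case by (rule eval_SuccE) simp
next
  case (Proj i xs z)
  from Proj.prems show ?case by (rule eval_ProjE) simp
next
  case (Comp xs gs ys f y z)
  from Comp.prems obtain ys' where gs: "list_all2 (\<lambda>g y. eval g xs y) gs ys'" and f: "eval f ys' z"
    by (rule eval_CompE)
  have unique: "y' = ys ! i" if "i < length gs" "eval (gs ! i) xs y'" for i y'
    using list_all2_nthD[OF Comp.IH(1) that(1)] that(2) by simp
  have "ys = ys'"
  proof (rule nth_equalityI)
    show "length ys = length ys'"
      using list_all2_lengthD[OF Comp.IH(1)] list_all2_lengthD[OF gs] by simp
  next
    fix i assume "i < length ys"
    then have i: "i < length gs"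
      using list_all2_lengthD[OF Comp.IH(1)] by simp
    show "ys ! i = ys' ! i"
      using unique[OF i list_all2_nthD[OF gs i]] by simp
  qed
  with Comp.IH(2) f show ?case by blast
next
  case (PrimRec_0 f xs y g z)
  from PrimRec_0.prems have "eval f xs z" by (rule eval_PrimRec_0E)
  then show ?case by (rule PrimRec_0.IH)
next
  case (PrimRec_Suc f g n xs y w z)
  from PrimRec_Suc.prems obtain y' where "eval (PrimRec f g) (n # xs) y'" "eval g (n # y' # xs) z"
    by (rule eval_PrimRec_SucE)
  with PrimRec_Suc.IH show ?case by blast
next
  case (Mu f n xs z)
  from Mu.prems have z: "eval f (z # xs) 0" "\<And>m. m < z \<Longrightarrow> \<exists>k. eval f (m # xs) (Suc k)"
    by (rule eval_MuE, blast)+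
  have "\<not> z < n" using Mu.IH(2) z(1) by (metis nat.distinct(1))
  moreover have "\<not> n < z" using Mu.IH(1) z(2) by (metis nat.distinct(1))
  ultimately show ?case by simp
qed

definition computable :: "(nat \<Rightarrow> nat) \<Rightarrow> bool" where
  "computable f \<longleftrightarrow> (\<exists>r. \<forall>n. eval r [n] (f n))"

text \<open>The cardinality is only meaningful when every fibre of \<open>f\<close> is finite. This holds for functions
  tending to infinity, and names of real numbers do so because the terms of their series tend to 0.\<close>

definition fibre_card :: "(nat \<Rightarrow> nat) \<Rightarrow> nat \<Rightarrow> nat" where
  "fibre_card f n = card {k. f k = n}"

definition is_name :: "(nat \<Rightarrow> nat) \<Rightarrow> real \<Rightarrow> bool" where
  "is_name f x \<longleftrightarrow> (\<lambda>k. 1 / 2 ^ f k) sums x"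

definition converges_computably :: "(nat \<Rightarrow> real) \<Rightarrow> bool" where
  "converges_computably X \<longleftrightarrow>
     (\<exists>x. X \<longlonglongrightarrow> x \<and>
       (\<exists>s. computable s \<and> (\<forall>n k. k \<ge> s n \<longrightarrow> \<bar>x - X k\<bar> \<le> 1 / 2 ^ n)))"

definition series_converges_computably :: "(nat \<Rightarrow> real) \<Rightarrow> bool" where
  "series_converges_computably a \<longleftrightarrow> converges_computably (\<lambda>n. \<Sum>k<n. a k)"

definition reordered_computable :: "real \<Rightarrow> bool" where
  "reordered_computable x \<longleftrightarrow>
     (\<exists>f. computable f \<and> is_name f x \<and>
       series_converges_computably (\<lambda>k. real (fibre_card f k) * (1 / 2 ^ k)))"

end

theory Submission
  imports Defs
begin

text \<open>Interleave the given names: if \<open>f\<close> names \<open>x\<close> and \<open>g\<close> names \<open>y\<close>, let \<open>h\<close> list the values of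
  \<open>f\<close> at the even arguments and those of \<open>g\<close> at the odd ones. Then \<open>h\<close> is a computable name of
  \<open>x + y\<close>, and every value is taken by \<open>h\<close> as often as by \<open>f\<close> and \<open>g\<close> together. So the partial
  sums of the multiplicity series of \<open>h\<close> are the sums of those of \<open>f\<close> and \<open>g\<close>
  (\<open>fibre_card_interleave\<close>), and a termwise sum of two computably convergent sequences converges
  computably, since one extra digit of precision in each summand absorbs the addition of the errors
  (\<open>converges_computably_add\<close>). The remaining work is to write programs for the functions involved.\<close>

section \<open>Closure properties of computable functions\<close>

lemma eval_Comp1:
  assumes "eval g xs y" and "eval f [y] z"
  shows "eval (Comp f [g]) xs z"
  by (rule eval.Comp[where ys = "[y]"]) (use assms in simp_all)

lemma eval_Comp2:
  assumes "eval g1 xs y1" and "eval g2 xs y2" and "eval f [y1, y2] z"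
  shows "eval (Comp f [g1, g2]) xs z"
  by (rule eval.Comp[where ys = "[y1, y2]"]) (use assms in simp_all)

lemma eval_Comp3:
  assumes "eval g1 xs y1" and "eval g2 xs y2" and "eval g3 xs y3" and "eval f [y1, y2, y3] z"
  shows "eval (Comp f [g1, g2, g3]) xs z"
  by (rule eval.Comp[where ys = "[y1, y2, y3]"]) (use assms in simp_all)

lemma eval_Proj: "i < length xs \<Longrightarrow> y = xs ! i \<Longrightarrow> eval (Proj i) xs y"
  by (simp add: eval.Proj)

definition add_recf :: recf where
  "add_recf = PrimRec (Proj 0) (Comp Succ [Proj 1])"

lemma eval_add_recf: "eval add_recf [m, n] (m + n)"
  unfolding add_recf_def
proof (induction m)
  case 0
  show ?case
    by (auto intro!: eval.PrimRec_0 eval_Proj)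
next
  case (Suc m)
  have "eval (Comp Succ [Proj 1]) [m, m + n, n] (Suc m + n)"
    by (auto intro!: eval_Comp1[where y = "m + n"] eval_Proj eval.Succ)
  with Suc show ?case
    by (rule eval.PrimRec_Suc)
qed

text \<open>Definition by cases is a primitive recursion whose step ignores the previous value: on
  \<open>[c, a, b]\<close> the base case returns \<open>a\<close>, while the step sees \<open>[m, previous, a, b]\<close> and returns
  \<open>b\<close>.\<close>

definition cond_recf :: recf where
  "cond_recf = PrimRec (Proj 0) (Proj 3)"

lemma eval_cond_recf: "eval cond_recf [c, a, b] (if c = 0 then a else b)"
  unfolding cond_recf_def
proof (induction c)
  case 0
  show ?case
    by (auto intro!: eval.PrimRec_0 eval_Proj)
next
  case (Suc c)
  have "eval (Proj 3) [c, if c = 0 then a else b, a, b] b"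
    by (simp add: eval_Proj)
  from eval.PrimRec_Suc[OF Suc this] show ?case
    by simp
qed

lemma computable_Suc: "computable Suc"
  unfolding computable_def by (blast intro: eval.Succ)

lemma computable_compose:
  assumes "computable f" and "computable g"
  shows "computable (\<lambda>n. f (g n))"
  using assms unfolding computable_def by (meson eval_Comp1)

lemma computable_add:
  assumes "computable f" and "computable g"
  shows "computable (\<lambda>n. f n + g n)"
  using assms unfolding computable_def by (meson eval_Comp2 eval_add_recf)

lemma computable_cond:
  assumes "computable c" and "computable f" and "computable g"
  shows "computable (\<lambda>n. if c n = 0 then f n else g n)"
  using assms unfolding computable_def by (meson eval_Comp3 eval_cond_recf)

definition mod2_recf :: recf where
  "mod2_recf = PrimRec Zero (Comp cond_recf [Proj 1, Comp Succ [Zero], Zero])"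

lemma eval_mod2_recf: "eval mod2_recf [n] (n mod 2)"
  unfolding mod2_recf_def
proof (induction n)
  case 0
  show ?case
    by (auto intro!: eval.PrimRec_0 eval.Zero)
next
  case (Suc n)
  have "eval (Comp cond_recf [Proj 1, Comp Succ [Zero], Zero]) [n, n mod 2]
          (if n mod 2 = 0 then Suc 0 else 0)"
    by (rule eval_Comp3[OF _ eval_Comp1[OF eval.Zero eval.Succ] eval.Zero eval_cond_recf])
      (simp add: eval_Proj)
  also have "(if n mod 2 = 0 then Suc 0 else 0) = Suc n mod 2"
    by presburger
  finally show ?case
    by (rule eval.PrimRec_Suc[OF Suc])
qed

lemma computable_mod2: "computable (\<lambda>n. n mod 2)"
  unfolding computable_def using eval_mod2_recf by blast

text \<open>Halving becomes primitive recursive through \<open>Suc n div 2 = n div 2 + n mod 2\<close>.\<close>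

lemma computable_div2: "computable (\<lambda>n. n div 2)"
proof -
  let ?step = "Comp add_recf [Proj 1, Comp mod2_recf [Proj 0]]"
  have "eval (PrimRec Zero ?step) [n] (n div 2)" for n
  proof (induction n)
    case 0
    show ?case
      by (auto intro!: eval.PrimRec_0 eval.Zero)
  next
    case (Suc n)
    have "eval ?step [n, n div 2] (n div 2 + n mod 2)"
      by (rule eval_Comp2[OF _ eval_Comp1[OF _ eval_mod2_recf] eval_add_recf])
        (simp_all add: eval_Proj)
    also have "n div 2 + n mod 2 = Suc n div 2"
      by presburger
    finally show ?case
      by (rule eval.PrimRec_Suc[OF Suc])
  qed
  then show ?thesis
    unfolding computable_def by blast
qed

section \<open>Interleaving two names\<close>

definition interleave :: "(nat \<Rightarrow> 'a) \<Rightarrow> (nat \<Rightarrow> 'a) \<Rightarrow> nat \<Rightarrow> 'a" where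
  "interleave f g n = (if even n then f (n div 2) else g (n div 2))"

lemma computable_interleave:
  assumes "computable f" and "computable g"
  shows "computable (interleave f g)"
proof -
  have "computable (\<lambda>n. if n mod 2 = 0 then f (n div 2) else g (n div 2))"
    by (intro computable_cond computable_mod2 computable_compose[OF _ computable_div2] assms)
  also have "(\<lambda>n. if n mod 2 = 0 then f (n div 2) else g (n div 2)) = interleave f g"
    by (simp add: fun_eq_iff interleave_def even_iff_mod_2_eq_zero)
  finally show ?thesis .
qed

lemma is_name_interleave:
  assumes "is_name f x" and "is_name g y"
  shows "is_name (interleave f g) (x + y)"
proof -
  have "(\<lambda>n. if even n then 1 / 2 ^ f (n div 2) else 1 / 2 ^ g ((n - 1) div 2)) sums (y + x)"
    using assms unfolding is_name_def by (intro sums_if)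
  also have "(\<lambda>n. if even n then 1 / 2 ^ f (n div 2) else 1 / 2 ^ g ((n - 1) div 2)) =
      (\<lambda>n. 1 / 2 ^ interleave f g n :: real)"
    by (auto simp: fun_eq_iff interleave_def elim!: oddE)
  finally show ?thesis
    by (simp add: is_name_def add.commute)
qed

text \<open>The terms of a convergent series tend to 0, so they cannot equal \<open>1 / 2 ^ n\<close> infinitely
  often.\<close>

lemma finite_fibre_of_name:
  assumes "is_name f x"
  shows "finite {k. f k = n}"
proof -
  have "(\<lambda>k. 1 / 2 ^ f k :: real) \<longlonglongrightarrow> 0"
    using assms unfolding is_name_def by (intro summable_LIMSEQ_zero sums_summable)
  then have "\<forall>\<^sub>F k in sequentially. 1 / 2 ^ f k < (1 / 2 ^ n :: real)"
    by (rule order_tendstoD) simp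
  then have "\<forall>\<^sub>F k in sequentially. f k \<noteq> n"
    by (rule eventually_mono) auto
  then show ?thesis
    by (simp add: eventually_cofinite flip: cofinite_eq_sequentially)
qed

lemma fibre_card_interleave:
  assumes "finite {k. f k = n}" and "finite {k. g k = n}"
  shows "fibre_card (interleave f g) n = fibre_card f n + fibre_card g n"
proof -
  let ?F = "{k. f k = n}" and ?G = "{k. g k = n}"
  let ?E = "(\<lambda>k. 2 * k) ` ?F" and ?O = "(\<lambda>k. Suc (2 * k)) ` ?G"
  have "{k. interleave f g k = n} = ?E \<union> ?O"
  proof (rule set_eqI)
    fix k
    show "k \<in> {k. interleave f g k = n} \<longleftrightarrow> k \<in> ?E \<union> ?O"
      by (cases "even k") (auto simp: interleave_def image_iff elim!: evenE oddE, presburger+)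
  qed
  moreover have "?E \<inter> ?O = {}"
    by (auto, presburger)
  moreover have "card ?E = card ?F" "card ?O = card ?G"
    by (auto intro!: card_image simp: inj_on_def)
  ultimately show ?thesis
    using assms by (simp add: fibre_card_def card_Un_disjoint)
qed

section \<open>Sums of computably convergent series\<close>

lemma converges_computably_add:
  assumes "converges_computably X" and "converges_computably Y"
  shows "converges_computably (\<lambda>n. X n + Y n)"
proof -
  obtain a s where a: "X \<longlonglongrightarrow> a" "computable s"
    and s: "\<And>n k. k \<ge> s n \<Longrightarrow> \<bar>a - X k\<bar> \<le> 1 / 2 ^ n"
    using assms(1) unfolding converges_computably_def by blast
  obtain b t where b: "Y \<longlonglongrightarrow> b" "computable t"
    and t: "\<And>n k. k \<ge> t n \<Longrightarrow> \<bar>b - Y k\<bar> \<le> 1 / 2 ^ n"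
    using assms(2) unfolding converges_computably_def by blast
  \<comment> \<open>Any bound above both moduli at precision \<open>Suc n\<close> will do; their sum is one.\<close>
  have "computable (\<lambda>n. s (Suc n) + t (Suc n))"
    by (intro computable_add computable_compose[OF _ computable_Suc] a b)
  moreover have "\<bar>(a + b) - (X k + Y k)\<bar> \<le> 1 / 2 ^ n" if "k \<ge> s (Suc n) + t (Suc n)" for n k
  proof -
    have "\<bar>a - X k\<bar> \<le> 1 / 2 ^ Suc n" "\<bar>b - Y k\<bar> \<le> 1 / 2 ^ Suc n"
      using s[of "Suc n" k] t[of "Suc n" k] that by linarith+
    moreover have "1 / 2 ^ Suc n + 1 / 2 ^ Suc n = (1 / 2 ^ n :: real)"
      by simp
    ultimately show ?thesis
      by linarith
  qed
  moreover have "(\<lambda>n. X n + Y n) \<longlonglongrightarrow> a + b"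
    using a b by (intro tendsto_add)
  ultimately show ?thesis
    unfolding converges_computably_def by blast
qed

lemma series_converges_computably_add:
  assumes "series_converges_computably a" and "series_converges_computably b"
  shows "series_converges_computably (\<lambda>k. a k + b k)"
  using assms unfolding series_converges_computably_def sum.distrib
  by (rule converges_computably_add)

section \<open>Closure of the reordered computable numbers under addition\<close>

theorem theorem16:
  fixes x y :: real
  assumes "reordered_computable x"
    and "reordered_computable y"
  shows "reordered_computable (x + y)"
proof -
  obtain f where f: "computable f" "is_name f x"
    "series_converges_computably (\<lambda>k. real (fibre_card f k) * (1 / 2 ^ k))"
    using assms(1) unfolding reordered_computable_def by blast
  obtain g where g: "computable g" "is_name g y"
    "series_converges_computably (\<lambda>k. real (fibre_card g k) * (1 / 2 ^ k))"
    using assms(2) unfolding reordered_computable_def by blast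
  have "fibre_card (interleave f g) k = fibre_card f k + fibre_card g k" for k
    using f(2) g(2) by (intro fibre_card_interleave finite_fibre_of_name)
  then have "series_converges_computably
      (\<lambda>k. real (fibre_card (interleave f g) k) * (1 / 2 ^ k))"
    using series_converges_computably_add[OF f(3) g(3)] by (simp add: distrib_right add_divide_distrib)
  then show ?thesis
    unfolding reordered_computable_def
    using computable_interleave[OF f(1) g(1)] is_name_interleave[OF f(2) g(2)] by blast
qed

end
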